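(* Let $0\le\varepsilon<1$. There exists an efficient (polynomial-time) adaptive algorithm which detects the target $t$ in any graph with $n$ vertices in at most $\frac{\log n}{1-\log(1+\varepsilon)}$ direction queries, by querying at each iteration an arbitrary $(1+\varepsilon)$-median of its current candidates' set for the potential function $\Gamma$.
   Context: All logarithms are base $2$. Graphs $G=(V,E)$, $|V|=n$, are connected, simple, undirected, with positive edge weights $w:E\to\mathbb{R}^+$; $d$ is the shortest-path distance, and $N(v)$ is the set of neighbors of $v$. For $u\in N(v)$, $N(v,u)=\{x\in V: d(v,x)=w(vu)+d(u,x)\}$ is the set of vertices $x$ for which some shortest path from $v$ to $x$ starts with the edge $vu$. There is one unknown target $t\in V$. A direction query at $v$ reveals that $v=t$ if this is the case, and otherwise returns a (possibly adversarially chosen) neighbor $u\in N(v)$ with $t\in N(v,u)$. For $S\subseteq V$ and $v\in V$, the potential is $\Gamma_S(v)=\max\{|N(v,u)\cap S|: u\in N(v)\}$. A vertex $x\in V$ is a $(1+\varepsilon)$-median of $S$ for $\Gamma$ if $\Gamma_S(x)\le(1+\varepsilon)\min_{v\in V}\Gamma_S(v)$. The candidates' set $S\subseteq V$ is a set maintained by the algorithm such that always $t\in S$; initially $S=V$, and after a query at $v$ with response $u\in N(v)$ it is replaced by $S\cap N(v,u)$. The target is detected when it is revealed by a query or when $|S|=1$. *)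

theory Defs
  imports
    "Graph_Theory.Graph_Theory"
    "HOL-Computational_Algebra.Polynomial"
begin

section \<open>Direction queries in weighted graphs\<close>

text \<open>
  An undirected edge is represented by its two opposite arcs, so that a simple undirected graph
  is a \<open>pair_graph\<close> (finite, loopless, symmetric) and the weight function has to agree on
  opposite arcs. The distance is \<open>\<mu> w\<close>, the infimum of the costs of all walks.
\<close>

datatype 'a answer = Here | Toward 'a

type_synonym 'a history = "('a \<times> 'a answer) list"

locale weighted_graph = pair_graph G
  for G :: "'a pair_pre_digraph" +
  fixes w :: "('a \<times> 'a) weight_fun"
  assumes connected: "Digraph_Component.connected (with_proj G)"
    and weight_pos: "e \<in> parcs G \<Longrightarrow> 0 < w e"
    and weight_sym: "(u, v) \<in> parcs G \<Longrightarrow> w (u, v) = w (v, u)"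
begin

definition nbrs :: "'a \<Rightarrow> 'a set" where
  "nbrs v = {u. (v, u) \<in> parcs G}"

definition toward :: "'a \<Rightarrow> 'a \<Rightarrow> 'a set" where
  "toward v u = {x \<in> pverts G. \<mu> w v x = ereal (w (v, u)) + \<mu> w u x}"

text \<open>
  The maximum is over a nonempty set unless the graph has a single vertex, in which case the
  target is detected without any query.
\<close>

definition potential :: "'a set \<Rightarrow> 'a \<Rightarrow> nat" where
  "potential S v = Max ((\<lambda>u. card (toward v u \<inter> S)) ` nbrs v)"

definition approx_median :: "real \<Rightarrow> 'a set \<Rightarrow> 'a \<Rightarrow> bool" where
  "approx_median \<epsilon> S x \<longleftrightarrow> x \<in> pverts G \<and>
     real (potential S x) \<le> (1 + \<epsilon>) * real (Min (potential S ` pverts G))"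

definition valid_answer :: "'a \<Rightarrow> 'a \<Rightarrow> 'a answer \<Rightarrow> bool" where
  "valid_answer t v a = (case a of
       Here \<Rightarrow> v = t
     | Toward u \<Rightarrow> v \<noteq> t \<and> u \<in> nbrs v \<and> t \<in> toward v u)"

text \<open>The answer may depend on the whole preceding interaction.\<close>

definition honest :: "'a \<Rightarrow> ('a history \<Rightarrow> 'a \<Rightarrow> 'a answer) \<Rightarrow> bool" where
  "honest t R \<longleftrightarrow> (\<forall>h. \<forall>v \<in> pverts G. valid_answer t v (R h v))"

text \<open>Histories are in chronological order.\<close>

definition candidates :: "'a history \<Rightarrow> 'a set" where
  "candidates h = foldl (\<lambda>S (v, a). case a of Here \<Rightarrow> S | Toward u \<Rightarrow> S \<inter> toward v u) (pverts G) h"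

definition detects :: "'a history \<Rightarrow> 'a \<Rightarrow> bool" where
  "detects h x \<longleftrightarrow> (x, Here) \<in> set h \<or> candidates h = {x}"

text \<open>
  The possible interactions, for the target \<open>t\<close>, of an algorithm that queries arbitrary
  \<open>(1 + \<epsilon>)\<close>-medians of its current candidates' set until the target is detected.
\<close>

inductive median_history :: "real \<Rightarrow> 'a \<Rightarrow> 'a history \<Rightarrow> bool" for \<epsilon> t where
  start: "median_history \<epsilon> t []"
| query: "median_history \<epsilon> t h \<Longrightarrow> \<nexists>x. detects h x \<Longrightarrow> approx_median \<epsilon> (candidates h) v
    \<Longrightarrow> valid_answer t v a \<Longrightarrow> median_history \<epsilon> t (h @ [(v, a)])"

end


section \<open>Programs with direction queries\<close>

text \<open>
  The machine model is a random access machine with one memory for natural numbers and one for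
  reals. A memory cell is addressed by an array name and a list of indices; scalars have the
  empty list of indices. There is no multiplication, no division, no rounding and no real constant
  other than 0, so that with unit costs, numbers cannot encode more than polynomially much
  information in polynomial time: natural numbers have polynomially many bits, and reals are
  integer combinations of the input reals with such coefficients.
\<close>

type_synonym cell = "string \<times> nat list"

datatype nexp =
    NConst nat
  | NCell string "nexp list"
  | NAdd nexp nexp
  | NSub nexp nexp

datatype rexp =
    RZero
  | RCell string "nexp list"
  | RAdd rexp rexp
  | RSub rexp rexp

datatype bexp =
    NLess nexp nexp
  | NEq nexp nexp
  | RLess rexp rexp
  | BNot bexp
  | BAnd bexp bexp

text \<open>\<open>Query x e\<close> queries the vertex \<open>e\<close> and stores the answer in the scalar \<open>x\<close>.\<close>

datatype program =
    Skip
  | NAssign string "nexp list" nexp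
  | RAssign string "nexp list" rexp
  | Query string nexp
  | Seq program program
  | If bexp program program
  | While bexp program

text \<open>The field \<open>transcript\<close> only records the interaction; programs cannot read it.\<close>

record state =
  nmem :: "cell \<Rightarrow> nat"
  rmem :: "cell \<Rightarrow> real"
  transcript :: "nat history"

primrec nval :: "state \<Rightarrow> nexp \<Rightarrow> nat" where
  "nval s (NConst k) = k"
| "nval s (NCell x es) = nmem s (x, map (nval s) es)"
| "nval s (NAdd a b) = nval s a + nval s b"
| "nval s (NSub a b) = nval s a - nval s b"

primrec rval :: "state \<Rightarrow> rexp \<Rightarrow> real" where
  "rval s RZero = 0"
| "rval s (RCell x es) = rmem s (x, map (nval s) es)"
| "rval s (RAdd a b) = rval s a + rval s b"
| "rval s (RSub a b) = rval s a - rval s b"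

primrec bval :: "state \<Rightarrow> bexp \<Rightarrow> bool" where
  "bval s (NLess a b) \<longleftrightarrow> nval s a < nval s b"
| "bval s (NEq a b) \<longleftrightarrow> nval s a = nval s b"
| "bval s (RLess a b) \<longleftrightarrow> rval s a < rval s b"
| "bval s (BNot b) \<longleftrightarrow> \<not> bval s b"
| "bval s (BAnd b c) \<longleftrightarrow> bval s b \<and> bval s c"

text \<open>
  The queried vertex itself stands for \<open>Here\<close>; no neighbor is confused with it, as there are
  no loops.
\<close>

definition answer_code :: "nat \<Rightarrow> nat answer \<Rightarrow> nat" where
  "answer_code v a = (case a of Here \<Rightarrow> v | Toward u \<Rightarrow> u)"

text \<open>
  \<open>exec R c s k s'\<close>: with queries answered by \<open>R\<close>, the program \<open>c\<close> started in \<open>s\<close> terminates in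
  \<open>s'\<close> after \<open>k\<close> steps. A step evaluates at most one test or assignment of the program, hence
  performs a number of elementary operations bounded by a constant that depends only on the program.
\<close>

inductive exec :: "(nat history \<Rightarrow> nat \<Rightarrow> nat answer) \<Rightarrow> program \<Rightarrow> state \<Rightarrow> nat \<Rightarrow> state \<Rightarrow> bool"
  for R where
  Skip: "exec R Skip s 1 s"
| NAssign: "exec R (NAssign x es e) s 1
    (s\<lparr>nmem := (nmem s)((x, map (nval s) es) := nval s e)\<rparr>)"
| RAssign: "exec R (RAssign x es e) s 1
    (s\<lparr>rmem := (rmem s)((x, map (nval s) es) := rval s e)\<rparr>)"
| Query: "v = nval s e \<Longrightarrow> a = R (transcript s) v \<Longrightarrow> exec R (Query x e) s 1
    (s\<lparr>nmem := (nmem s)((x, []) := answer_code v a), transcript := transcript s @ [(v, a)]\<rparr>)"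
| Seq: "exec R c s k s' \<Longrightarrow> exec R d s' l s'' \<Longrightarrow> exec R (Seq c d) s (k + l) s''"
| IfTrue: "bval s b \<Longrightarrow> exec R c s k s' \<Longrightarrow> exec R (If b c d) s (Suc k) s'"
| IfFalse: "\<not> bval s b \<Longrightarrow> exec R d s k s' \<Longrightarrow> exec R (If b c d) s (Suc k) s'"
| WhileFalse: "\<not> bval s b \<Longrightarrow> exec R (While b c) s 1 s"
| WhileTrue: "bval s b \<Longrightarrow> exec R c s k s' \<Longrightarrow> exec R (While b c) s' l s''
    \<Longrightarrow> exec R (While b c) s (Suc (k + l)) s''"

inductive_cases exec_SkipE: "exec R Skip s k s'"
  and exec_NAssignE: "exec R (NAssign x es e) s k s'"
  and exec_RAssignE: "exec R (RAssign x es e) s k s'"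
  and exec_QueryE: "exec R (Query x e) s k s'"
  and exec_SeqE: "exec R (Seq c d) s k s'"
  and exec_IfE: "exec R (If b c d) s k s'"
  and exec_WhileE: "exec R (While b c) s k s'"

text \<open>For a fixed oracle, a program has at most one terminating execution.\<close>

lemma exec_deterministic:
  "exec R c s k s' \<Longrightarrow> exec R c s l s'' \<Longrightarrow> l = k \<and> s'' = s'"
proof (induction arbitrary: l s'' rule: exec.induct)
  case Skip
  from Skip show ?case by (rule exec_SkipE) simp
next
  case NAssign
  from NAssign show ?case by (rule exec_NAssignE) simp
next
  case RAssign
  from RAssign show ?case by (rule exec_RAssignE) simp
next
  case (Query v s e a x)
  from Query(3) show ?case by (rule exec_QueryE) (simp add: Query(1,2))
next
  case (Seq c s k s' d m s2)
  from Seq.prems show ?case by (rule exec_SeqE) (metis Seq.IH)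
next
  case (IfTrue s b c k s' d)
  from IfTrue.prems show ?case
    by (rule exec_IfE) (use IfTrue.hyps IfTrue.IH in \<open>metis\<close>)+
next
  case (IfFalse s b d k s' c)
  from IfFalse.prems show ?case
    by (rule exec_IfE) (use IfFalse.hyps IfFalse.IH in \<open>metis\<close>)+
next
  case (WhileFalse s b c)
  from WhileFalse.prems show ?case by (rule exec_WhileE) (use WhileFalse.hyps in simp_all)
next
  case (WhileTrue s b c k s' m s2)
  from WhileTrue.prems show ?case
    by (rule exec_WhileE) (use WhileTrue.hyps WhileTrue.IH in \<open>metis\<close>)+
qed

text \<open>
  Graphs on the vertices \<open>0, \<dots>, n - 1\<close> are given by \<open>n\<close>, the adjacency matrix and the matrix of the
  edge weights. All other cells are 0.
\<close>

definition input :: "nat \<Rightarrow> nat pair_pre_digraph \<Rightarrow> (nat \<times> nat) weight_fun \<Rightarrow> state" where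
  "input n G w = \<lparr>
     nmem = (\<lambda>(x, js). if x = ''n'' \<and> js = [] then n
       else if x = ''adj'' \<and> (\<exists>i j. js = [i, j] \<and> (i, j) \<in> parcs G) then 1 else 0),
     rmem = (\<lambda>(x, js). if x = ''w'' \<and> (\<exists>i j. js = [i, j] \<and> (i, j) \<in> parcs G)
       then w (js ! 0, js ! 1) else 0),
     transcript = []\<rparr>"

definition result :: "state \<Rightarrow> nat" where
  "result s = nmem s (''target'', [])"

end

theory Submission
  imports Defs
begin

text \<open>
  A vertex \<open>v\<close> minimizing the sum of the distances to \<open>S\<close> has potential at most \<open>|S| / 2\<close>: moving to a
  neighbor \<open>u\<close> brings the vertices of \<open>toward v u \<inter> S\<close> closer by the weight of the edge and the others
  farther by at most as much. Hence every query of a \<open>(1 + \<epsilon>)\<close>-median multiplies the number of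
  candidates by at most \<open>(1 + \<epsilon>) / 2\<close>. Before the last query there are at least two candidates and
  \<open>2 (1 + \<epsilon>) / 2 \<ge> 1\<close>, so the bound also covers a last query at the target itself.

  The program computes all distances by Bellman--Ford and then always queries an exact median. The
  number of candidates strictly decreases with each query, so every execution of any of its loops
  has at most \<open>n\<close> iterations, and a cost polynomial can be read off the syntax.
\<close>

section \<open>Medians and the number of queries\<close>

context weighted_graph
begin

section \<open>Distances as real numbers\<close>

definition distance :: "'a \<Rightarrow> 'a \<Rightarrow> real" where
  "distance u v = real_of_ereal (\<mu> w u v)"

lemma reachable: "u \<in> pverts G \<Longrightarrow> v \<in> pverts G \<Longrightarrow> u \<rightarrow>\<^sup>*\<^bsub>with_proj G\<^esub> v"
  using symmetric_connected_imp_strongly_connected[OF sym_arcs connected]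
  by (auto elim: strongly_connectedE)

text \<open>Positive weights rule out negative cycles, so the infimum over all walks is attained by
  a path. It is therefore finite, and nothing is lost by passing to real numbers.\<close>

lemma shortest_apath:
  assumes "u \<in> pverts G" "v \<in> pverts G"
  obtains p where "apath u p v" "\<mu> w u v = ereal (awalk_cost w p)" "distance u v = awalk_cost w p"
  using min_cost_awalk[OF reachable[OF assms], of w] weight_pos
  by (force simp: distance_def intro: less_imp_le)

lemma mu_eq_distance: "u \<in> pverts G \<Longrightarrow> v \<in> pverts G \<Longrightarrow> \<mu> w u v = ereal (distance u v)"
  by (metis shortest_apath)

lemma distance_le_awalk_cost: "awalk u p v \<Longrightarrow> distance u v \<le> awalk_cost w p"
  using min_cost_le_walk_cost[of u p v w] mu_eq_distance[of u v] by auto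

lemma distance_self: "v \<in> pverts G \<Longrightarrow> distance v v = 0"
  using shortest_apath[of v v] by (metis apath_nonempty_ends awalk_cost_Nil)

lemma distance_le_arc:
  assumes "(v, u) \<in> parcs G" "x \<in> pverts G"
  shows "distance v x \<le> w (v, u) + distance u x"
proof -
  obtain p where p: "apath u p x" "distance u x = awalk_cost w p"
    using shortest_apath assms in_arcsD2 by metis
  have "awalk v ((v, u) # p) x"
    using p assms by (auto simp: apath_def awalk_Cons_iff)
  from distance_le_awalk_cost[OF this] show ?thesis
    using p by simp
qed

text \<open>A shortest path repeats no arc, so its cost is a sum over a set of arcs. This makes the
  total weight a safe substitute for infinity.\<close>

lemma distance_le_total_weight:
  assumes "u \<in> pverts G" "v \<in> pverts G"
  shows "distance u v \<le> sum w (parcs G)"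
proof -
  obtain p where p: "apath u p v" "distance u v = awalk_cost w p"
    using shortest_apath assms by metis
  have "distinct p" "set p \<subseteq> parcs G"
    using p(1) distinct_verts_imp_distinct by (auto simp: apath_def)
  then have "awalk_cost w p = sum w (set p)"
    by (simp add: awalk_cost_def sum_list_distinct_conv_sum_set)
  also have "\<dots> \<le> sum w (parcs G)"
    by (rule sum_mono2) (use \<open>set p \<subseteq> _\<close> weight_pos in \<open>force intro: less_imp_le\<close>)+
  finally show ?thesis using p by simp
qed

section \<open>Neighbors and vertices of small potential\<close>

lemma toward_iff:
  assumes "u \<in> nbrs v" "x \<in> pverts G"
  shows "x \<in> toward v u \<longleftrightarrow> distance v x = w (v, u) + distance u x"
  using assms in_arcsD1 in_arcsD2
  by (auto simp: toward_def nbrs_def mu_eq_distance)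

lemma finite_nbrs: "finite (nbrs v)"
  by (rule finite_subset[OF _ pair_finite_verts]) (auto simp: nbrs_def dest: in_arcsD2)

text \<open>The first arc of a path to \<open>x\<close> leads to a neighbor. Hence the maximum in
  \<open>potential\<close> ranges over a nonempty set.\<close>

lemma nbrs_nonempty:
  assumes "v \<in> pverts G" "x \<in> pverts G" "x \<noteq> v"
  shows "nbrs v \<noteq> {}"
proof -
  obtain p where p: "apath v p x" using shortest_apath assms by metis
  with \<open>x \<noteq> v\<close> show ?thesis
    by (cases p) (auto simp: apath_Cons_iff apath_Nil_iff nbrs_def)
qed

lemma exists_potential_le_half:
  assumes "S \<subseteq> pverts G" "x \<in> pverts G" "y \<in> pverts G" "x \<noteq> y"
  shows "\<exists>v \<in> pverts G. 2 * potential S v \<le> card S"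
proof -
  define \<Phi> where "\<Phi> v = (\<Sum>x\<in>S. distance v x)" for v
  obtain v where v: "v \<in> pverts G" "\<And>u. u \<in> pverts G \<Longrightarrow> \<Phi> v \<le> \<Phi> u"
    using ex_is_arg_min_if_finite[of "pverts G" \<Phi>] pair_finite_verts assms
    by (auto simp: is_arg_min_def not_less)
  have [simp]: "finite S" using assms(1) pair_finite_verts finite_subset by blast
  have "2 * card (toward v u \<inter> S) \<le> card S" if u: "u \<in> nbrs v" for u
  proof -
    have arc: "(v, u) \<in> parcs G" "(u, v) \<in> parcs G" "u \<in> pverts G"
      using u arcs_symmetric in_arcsD2 by (auto simp: nbrs_def)
    \<comment> \<open>Inside \<open>toward v u\<close> the distance drops by exactly the weight of
      the edge; elsewhere the opposite arc and the symmetry of the weights bound the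
      increase.\<close>
    have "\<Phi> u \<le> (\<Sum>x\<in>S. distance v x + w (v, u) - (if x \<in> toward v u then 2 * w (v, u) else 0))"
      unfolding \<Phi>_def
    proof (rule sum_mono)
      fix x assume "x \<in> S"
      then have "x \<in> pverts G" using assms(1) by auto
      then show "distance u x \<le> distance v x + w (v, u) - (if x \<in> toward v u then 2 * w (v, u) else 0)"
        using distance_le_arc[OF arc(2), of x] weight_sym[OF arc(1)] toward_iff[OF u, of x]
        by simp
    qed
    also have "\<dots> = \<Phi> v + card S * w (v, u) - 2 * w (v, u) * card (toward v u \<inter> S)"
      by (simp add: \<Phi>_def sum_subtractf sum.distrib sum.inter_restrict[symmetric] Int_commute
          flip: sum.inter_filter)
    \<comment> \<open>Minimality gives \<open>\<Phi> v \<le> \<Phi> u\<close>; the positive weight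
      then cancels.\<close>
    finally have "2 * w (v, u) * card (toward v u \<inter> S) \<le> card S * w (v, u)"
      using v(2)[OF arc(3)] by simp
    then have "w (v, u) * (2 * card (toward v u \<inter> S)) \<le> w (v, u) * card S"
      by (simp add: mult_ac)
    then show ?thesis
      using weight_pos[OF arc(1)] by (simp add: mult_le_cancel_left_pos flip: of_nat_mult)
  qed
  moreover have "nbrs v \<noteq> {}"
    using nbrs_nonempty v(1) assms by metis
  then have "potential S v \<in> (\<lambda>u. card (toward v u \<inter> S)) ` nbrs v"
    unfolding potential_def by (intro Max_in) (auto simp: finite_nbrs)
  ultimately show ?thesis using v(1) by (intro bexI[of _ v]) auto
qed

lemma card_toward_le_potential: "u \<in> nbrs v \<Longrightarrow> card (toward v u \<inter> S) \<le> potential S v"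
  unfolding potential_def by (intro Max_ge) (auto simp: finite_nbrs)

section \<open>Candidates and the length of median histories\<close>

lemma candidates_Nil: "candidates [] = pverts G"
  by (simp add: candidates_def)

lemma candidates_snoc:
  "candidates (h @ [(v, a)]) = (case a of Here \<Rightarrow> candidates h | Toward u \<Rightarrow> candidates h \<inter> toward v u)"
  unfolding candidates_def foldl_append by (cases a) simp_all

lemma candidates_subset: "candidates h \<subseteq> pverts G"
  by (induction h rule: rev_induct) (auto simp: candidates_Nil candidates_snoc split: answer.splits)

lemma finite_candidates: "finite (candidates h)"
  using candidates_subset pair_finite_verts finite_subset by blast

lemma approx_median_potential_le:
  assumes "approx_median \<epsilon> S v" "S \<subseteq> pverts G" "x \<in> S" "y \<in> S" "x \<noteq> y" "0 \<le> \<epsilon>"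
  shows "real (potential S v) \<le> (1 + \<epsilon>) / 2 * card S"
proof -
  obtain z where z: "z \<in> pverts G" "2 * potential S z \<le> card S"
    using exists_potential_le_half[OF assms(2), of x y] assms by blast
  have "Min (potential S ` pverts G) \<le> potential S z"
    using z by (intro Min_le) (auto simp: pair_finite_verts)
  then have "real (Min (potential S ` pverts G)) \<le> card S / 2"
    using z(2) by linarith
  then have "(1 + \<epsilon>) * real (Min (potential S ` pverts G)) \<le> (1 + \<epsilon>) * (card S / 2)"
    using assms(6) by (intro mult_left_mono) auto
  then show ?thesis using assms(1) by (auto simp: approx_median_def)
qed

text \<open>This lets one program, which queries exact medians, serve all values of
  \<epsilon>.\<close>

lemma approx_median_if_minimal:
  assumes "v \<in> pverts G" "\<And>u. u \<in> pverts G \<Longrightarrow> potential S v \<le> potential S u" "0 \<le> \<epsilon>"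
  shows "approx_median \<epsilon> S v"
proof -
  have "potential S v = Min (potential S ` pverts G)"
    using assms pair_finite_verts by (intro Min_eqI[symmetric]) auto
  then show ?thesis
    using assms(1,3) by (auto simp: approx_median_def algebra_simps)
qed

text \<open>There are finitely many vertices, so some vertex minimizes the potential; the strategy
  never lacks a vertex to query.\<close>

lemma exists_approx_median:
  assumes "pverts G \<noteq> {}" "0 \<le> \<epsilon>"
  shows "\<exists>v. approx_median \<epsilon> S v"
  using ex_is_arg_min_if_finite[OF pair_finite_verts assms(1), of "potential S"]
    approx_median_if_minimal[OF _ _ assms(2)]
  by (auto simp: is_arg_min_def not_less)

lemma target_mem_candidates:
  assumes "median_history \<epsilon> t h" "t \<in> pverts G"
  shows "t \<in> candidates h"
  using assms
  by induction
    (auto simp: candidates_Nil candidates_snoc valid_answer_def split: answer.splits)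

lemma two_candidates:
  assumes "median_history \<epsilon> t h" "t \<in> pverts G" "\<nexists>x. detects h x"
  obtains x where "x \<in> candidates h" "x \<noteq> t"
  using target_mem_candidates[OF assms(1,2)] assms(3) by (auto simp: detects_def)

text \<open>The first conjunct is what survives detection: an answer \<open>Here\<close> leaves the
  candidates unchanged, so the bound on their number may fail after the last query. Until then the
  second conjunct carries the geometric decrease.\<close>

lemma median_history_card:
  assumes "median_history \<epsilon> t h" "t \<in> pverts G" "0 \<le> \<epsilon>"
  shows "1 \<le> ((1 + \<epsilon>) / 2) ^ length h * card (pverts G) \<and>
    ((\<nexists>x. detects h x) \<longrightarrow> card (candidates h) \<le> ((1 + \<epsilon>) / 2) ^ length h * card (pverts G))"
  using assms(1)
proof induction
  case start
  have "0 < card (pverts G)" using assms(2) pair_finite_verts by (auto simp: card_gt_0_iff)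
  then show ?case by (simp add: candidates_Nil)
next
  case (query h v a)
  obtain x where x: "x \<in> candidates h" "x \<noteq> t"
    using two_candidates query.hyps(1,2) assms(2) by metis
  note t = target_mem_candidates[OF query.hyps(1) assms(2)]
  have "card {x, t} \<le> card (candidates h)"
    using x t by (intro card_mono finite_candidates) auto
  then have two: "2 \<le> card (candidates h)" using x by simp
  have le: "(1 + \<epsilon>) / 2 * card (candidates h) \<le> ((1 + \<epsilon>) / 2) ^ length (h @ [(v, a)]) * card (pverts G)"
    using query mult_left_mono[of "card (candidates h)" _ "(1 + \<epsilon>) / 2"] assms(3)
    by (auto simp: mult_ac)
  have "1 \<le> (1 + \<epsilon>) / 2 * card (candidates h)"
    using mult_mono[of 1 "1 + \<epsilon>" 1 "card (candidates h) / 2"] two assms(3) by auto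
  moreover have "card (candidates (h @ [(v, a)])) \<le> (1 + \<epsilon>) / 2 * card (candidates h)"
    if undetected: "\<nexists>x. detects (h @ [(v, a)]) x"
  proof -
    obtain u where u: "a = Toward u" "u \<in> nbrs v"
      using undetected query.hyps(4) by (cases a) (auto simp: detects_def valid_answer_def)
    have "card (candidates (h @ [(v, a)])) \<le> potential (candidates h) v"
      using card_toward_le_potential[OF u(2), of "candidates h"] u(1)
      by (simp add: candidates_snoc Int_commute)
    moreover have "real (potential (candidates h) v) \<le> (1 + \<epsilon>) / 2 * card (candidates h)"
      using approx_median_potential_le[OF query.hyps(3) candidates_subset x(1) t x(2) assms(3)] .
    ultimately show ?thesis by linarith
  qed
  ultimately show ?case using le by auto
qed

text \<open>In logarithms, each query costs \<open>1 - log 2 (1 + \<epsilon>)\<close>, which is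
  positive since \<epsilon> < 1, and the total cost cannot exceed the logarithm of the number of
  vertices.\<close>

lemma median_history_length:
  assumes "median_history \<epsilon> t h" "t \<in> pverts G" "0 \<le> \<epsilon>" "\<epsilon> < 1"
  shows "length h \<le> log 2 (card (pverts G)) / (1 - log 2 (1 + \<epsilon>))"
proof -
  have pos: "0 < card (pverts G)" using assms(2) pair_finite_verts by (auto simp: card_gt_0_iff)
  have "1 \<le> ((1 + \<epsilon>) / 2) ^ length h * card (pverts G)"
    using median_history_card[OF assms(1-3)] by blast
  then have "0 \<le> log 2 (((1 + \<epsilon>) / 2) ^ length h * card (pverts G))"
    by simp
  also have "\<dots> = log 2 (card (pverts G)) - length h * (1 - log 2 (1 + \<epsilon>))"
    using pos assms(2,3) by (auto simp: log_mult log_nat_power log_divide algebra_simps)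
  finally have "length h * (1 - log 2 (1 + \<epsilon>)) \<le> log 2 (card (pverts G))" by simp
  moreover have "log 2 (1 + \<epsilon>) < 1" using assms(3,4) by simp
  ultimately show ?thesis by (simp add: pos_le_divide_eq)
qed

end

section \<open>Total correctness with cost bounds\<close>

text \<open>The cost of a program in which every execution of a loop has at most \<open>n\<close> iterations.\<close>

primrec cost_poly :: "program \<Rightarrow> nat poly" where
  "cost_poly Skip = 1"
| "cost_poly (NAssign x es e) = 1"
| "cost_poly (RAssign x es e) = 1"
| "cost_poly (Query x e) = 1"
| "cost_poly (Seq c d) = cost_poly c + cost_poly d"
| "cost_poly (If b c d) = 1 + cost_poly c + cost_poly d"
| "cost_poly (While b c) = 1 + [:0, 1:] * (1 + cost_poly c)"

text \<open>Total correctness with a built-in budget. The rules below are applied backwards from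
  \<open>Q\<close>, and proofs about concrete programs never mention costs.\<close>

definition runs :: "(nat history \<Rightarrow> nat \<Rightarrow> nat answer) \<Rightarrow> nat \<Rightarrow> program \<Rightarrow> state \<Rightarrow> (state \<Rightarrow> bool) \<Rightarrow> bool" where
  "runs R n c s Q \<longleftrightarrow> (\<exists>k s'. exec R c s k s' \<and> k \<le> poly (cost_poly c) n \<and> Q s')"

lemma runs_mono: "runs R n c s P \<Longrightarrow> (\<And>s'. P s' \<Longrightarrow> Q s') \<Longrightarrow> runs R n c s Q"
  unfolding runs_def by blast

lemma runs_Skip: "Q s \<Longrightarrow> runs R n Skip s Q"
  unfolding runs_def using exec.Skip by fastforce

lemma runs_NAssign:
  "Q (s\<lparr>nmem := (nmem s)((x, map (nval s) es) := nval s e)\<rparr>) \<Longrightarrow> runs R n (NAssign x es e) s Q"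
  unfolding runs_def using exec.NAssign by fastforce

lemma runs_RAssign:
  "Q (s\<lparr>rmem := (rmem s)((x, map (nval s) es) := rval s e)\<rparr>) \<Longrightarrow> runs R n (RAssign x es e) s Q"
  unfolding runs_def using exec.RAssign by fastforce

lemma runs_Query:
  assumes "Q (s\<lparr>nmem := (nmem s)((x, []) := answer_code (nval s e) (R (transcript s) (nval s e))),
    transcript := transcript s @ [(nval s e, R (transcript s) (nval s e))]\<rparr>)"
  shows "runs R n (Query x e) s Q"
  unfolding runs_def using assms exec.Query[OF refl refl] by fastforce

lemma runs_Seq: "runs R n c s (\<lambda>s'. runs R n d s' Q) \<Longrightarrow> runs R n (Seq c d) s Q"
  unfolding runs_def using exec.Seq by (fastforce intro: add_mono)

text \<open>\<open>cost_poly\<close> adds the budgets of both branches, as the maximum of two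
  polynomials need not be a polynomial; either branch fits.\<close>

lemma runs_If:
  assumes "bval s b \<Longrightarrow> runs R n c s Q" "\<not> bval s b \<Longrightarrow> runs R n d s Q"
  shows "runs R n (If b c d) s Q"
proof (cases "bval s b")
  case True
  then obtain k s' where "exec R c s k s'" "k \<le> poly (cost_poly c) n" "Q s'"
    using assms(1) by (auto simp: runs_def)
  then show ?thesis using exec.IfTrue[OF True]
    unfolding runs_def by (intro exI[of _ "Suc k"] exI[of _ s']) auto
next
  case False
  then obtain k s' where "exec R d s k s'" "k \<le> poly (cost_poly d) n" "Q s'"
    using assms(2) by (auto simp: runs_def)
  then show ?thesis using exec.IfFalse[OF False]
    unfolding runs_def by (intro exI[of _ "Suc k"] exI[of _ s']) auto
qed

lemmas runs_intros = runs_Skip runs_NAssign runs_RAssign runs_Query runs_Seq runs_If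

text \<open>The measure \<open>m\<close> starts at no more than \<open>n\<close> and drops in every
  iteration, and all iterations share the same budget.\<close>

lemma runs_While:
  fixes m :: "state \<Rightarrow> nat"
  assumes "I s" "m s \<le> n"
    and step: "\<And>s. I s \<Longrightarrow> bval s b \<Longrightarrow> runs R n c s (\<lambda>s'. I s' \<and> m s' < m s)"
    and exit: "\<And>s. I s \<Longrightarrow> \<not> bval s b \<Longrightarrow> Q s"
  shows "runs R n (While b c) s Q"
proof -
  let ?T = "Suc (poly (cost_poly c) n)"
  \<comment> \<open>Counting with \<open>m s\<close> in place of \<open>n\<close> makes the bound
    shrink along the iterations, as the induction requires.\<close>
  have "\<exists>k s'. exec R (While b c) s k s' \<and> k \<le> Suc (m s * ?T) \<and> Q s'"
    using \<open>I s\<close>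
  proof (induction "m s" arbitrary: s rule: less_induct)
    case (less s)
    show ?case
    proof (cases "bval s b")
      case True
      obtain k s' where k: "exec R c s k s'" "k \<le> poly (cost_poly c) n" "I s'" "m s' < m s"
        using step[OF less.prems True] by (auto simp: runs_def)
      obtain l s'' where l: "exec R (While b c) s' l s''" "l \<le> Suc (m s' * ?T)" "Q s''"
        using less.hyps[OF k(4,3)] by blast
      have "Suc (m s') * ?T \<le> m s * ?T"
        using k(4) by (intro mult_le_mono1) simp
      then have "Suc (k + l) \<le> Suc (m s * ?T)"
        using k(2) l(2) by simp
      then show ?thesis using exec.WhileTrue[OF True k(1) l(1)] l(3) by blast
    next
      case False
      then show ?thesis using exec.WhileFalse exit[OF less.prems] by fastforce
    qed
  qed
  moreover have "Suc (m s * ?T) \<le> poly (cost_poly (While b c)) n"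
    using mult_le_mono1[OF \<open>m s \<le> n\<close>, of ?T] by simp
  ultimately show ?thesis unfolding runs_def by (meson order_trans)
qed

section \<open>Counting loops and frame conditions\<close>

abbreviation NVar :: "string \<Rightarrow> nexp" where
  "NVar x \<equiv> NCell x []"

definition For :: "string \<Rightarrow> program \<Rightarrow> program" where
  "For x c = Seq (NAssign x [] (NConst 0)) (While (NLess (NVar x) (NVar ''n''))
     (Seq c (NAssign x [] (NAdd (NVar x) (NConst 1)))))"

text \<open>The measure is \<open>n\<close> minus the counter. The body has to leave the counter and
  the cell \<open>n\<close> intact, and its invariant concerns the state after the increment because
  the increment belongs to the loop.\<close>

lemma runs_For:
  assumes start: "nmem s (''n'', []) = n" "I 0 (s\<lparr>nmem := (nmem s)((x, []) := 0)\<rparr>)"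
    and step: "\<And>i s. i < n \<Longrightarrow> I i s \<Longrightarrow> nmem s (x, []) = i \<Longrightarrow> nmem s (''n'', []) = n \<Longrightarrow>
      runs R n c s (\<lambda>s'. nmem s' (x, []) = i \<and> nmem s' (''n'', []) = n \<and>
        I (Suc i) (s'\<lparr>nmem := (nmem s')((x, []) := Suc i)\<rparr>))"
    and exit: "\<And>s. I n s \<Longrightarrow> nmem s (''n'', []) = n \<Longrightarrow> Q s"
    and "x \<noteq> ''n''"
  shows "runs R n (For x c) s Q"
  unfolding For_def
proof (rule runs_Seq, rule runs_NAssign,
    rule runs_While[where I = "\<lambda>s. nmem s (''n'', []) = n \<and> nmem s (x, []) \<le> n \<and> I (nmem s (x, [])) s"
      and m = "\<lambda>s. n - nmem s (x, [])"], goal_cases)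
  case 1
  then show ?case using start \<open>x \<noteq> ''n''\<close> by simp
next
  case 2
  then show ?case by simp
next
  case (3 s)
  then have "nmem s (x, []) < n" by simp
  show ?case
    by (rule runs_Seq, rule runs_mono[OF step[of "nmem s (x, [])" s]], use 3 in simp_all,
        rule runs_NAssign, use \<open>x \<noteq> ''n''\<close> in auto)
next
  case (4 s)
  then have "I n s" by auto
  then show ?case using exit 4 by blast
qed

definition agree :: "string set \<Rightarrow> (cell \<Rightarrow> nat) \<Rightarrow> (cell \<Rightarrow> nat) \<Rightarrow> bool" where
  "agree X N N' \<longleftrightarrow> (\<forall>x es. x \<notin> X \<longrightarrow> N' (x, es) = N (x, es))"

lemma agree_refl [simp]: "agree X N N"
  by (simp add: agree_def)

lemma agree_update [simp]: "x \<in> X \<Longrightarrow> agree X N (N'((x, es) := k)) \<longleftrightarrow> agree X N N'"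
  by (auto simp: agree_def)

text \<open>Frame condition for the programs that run once the distances are known: apart from
  queries, these write natural numbers only, in arrays named in \<open>X\<close>.\<close>

definition keeps :: "string set \<Rightarrow> state \<Rightarrow> state \<Rightarrow> bool" where
  "keeps X s s' \<longleftrightarrow> rmem s' = rmem s \<and> transcript s' = transcript s \<and> agree X (nmem s) (nmem s')"

lemma keeps_trans: "keeps X s s' \<Longrightarrow> keeps Y s' s'' \<Longrightarrow> X \<subseteq> Z \<Longrightarrow> Y \<subseteq> Z \<Longrightarrow> keeps Z s s''"
  unfolding keeps_def agree_def by (metis subsetD)

section \<open>The program\<close>

text \<open>
  The cells \<open>C [x]\<close> mark the candidates and \<open>cnt\<close> is their number, except that \<open>cnt\<close> is set to 0 when
  the target answers a query. The total weight \<open>W\<close> serves as an infinite initial distance.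
\<close>

definition arc_test :: "nexp \<Rightarrow> nexp \<Rightarrow> bexp" where
  "arc_test a b = NEq (NCell ''adj'' [a, b]) (NConst 1)"

definition via :: "nexp \<Rightarrow> nexp \<Rightarrow> nexp \<Rightarrow> rexp" where
  "via a b c = RAdd (RCell ''w'' [a, b]) (RCell ''d'' [b, c])"

definition total_weight :: program where
  "total_weight = For ''i'' (For ''j'' (RAssign ''W'' []
     (RAdd (RCell ''W'' []) (RCell ''w'' [NVar ''i'', NVar ''j'']))))"

definition init_distances :: program where
  "init_distances = For ''i'' (For ''j'' (If (NEq (NVar ''i'') (NVar ''j''))
     (RAssign ''d'' [NVar ''i'', NVar ''j''] RZero)
     (RAssign ''d'' [NVar ''i'', NVar ''j''] (RCell ''W'' []))))"

definition relax :: program where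
  "relax = If (BAnd (arc_test (NVar ''i'') (NVar ''u''))
       (RLess (via (NVar ''i'') (NVar ''u'') (NVar ''j'')) (RCell ''d'' [NVar ''i'', NVar ''j''])))
     (RAssign ''d'' [NVar ''i'', NVar ''j''] (via (NVar ''i'') (NVar ''u'') (NVar ''j''))) Skip"

text \<open>All pairs at once: each round tries every first arc for every pair, so the walks taken
  into account grow by one arc at the front.\<close>

definition bellman_ford :: program where
  "bellman_ford = For ''r'' (For ''i'' (For ''u'' (For ''j'' relax)))"

definition init_candidates :: program where
  "init_candidates = Seq (For ''x'' (NAssign ''C'' [NVar ''x''] (NConst 1)))
     (NAssign ''cnt'' [] (NVar ''n''))"

text \<open>Tests compare reals only by strict inequality, so equality is expressed by two negated
  comparisons.\<close>

definition toward_test :: "string \<Rightarrow> string \<Rightarrow> bexp" where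
  "toward_test a b = BAnd (NEq (NCell ''C'' [NVar ''x'']) (NConst 1))
     (BAnd (BNot (RLess (RCell ''d'' [NVar a, NVar ''x'']) (via (NVar a) (NVar b) (NVar ''x''))))
       (BNot (RLess (via (NVar a) (NVar b) (NVar ''x'')) (RCell ''d'' [NVar a, NVar ''x'']))))"

definition count_toward :: program where
  "count_toward = Seq (NAssign ''c'' [] (NConst 0))
     (For ''x'' (If (toward_test ''v'' ''u'') (NAssign ''c'' [] (NAdd (NVar ''c'') (NConst 1))) Skip))"

definition compute_potential :: program where
  "compute_potential = Seq (NAssign ''pot'' [] (NConst 0))
     (For ''u'' (If (arc_test (NVar ''v'') (NVar ''u''))
       (Seq count_toward (If (NLess (NVar ''pot'') (NVar ''c'')) (NAssign ''pot'' [] (NVar ''c'')) Skip))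
       Skip))"

text \<open>Vertex 0 is accepted unconditionally, which spares an infinite initial value of
  \<open>min\<close>.\<close>

definition find_median :: program where
  "find_median = For ''v'' (Seq compute_potential
     (If (BAnd (BNot (NEq (NVar ''v'') (NConst 0))) (BNot (NLess (NVar ''pot'') (NVar ''min''))))
       Skip (Seq (NAssign ''best'' [] (NVar ''v'')) (NAssign ''min'' [] (NVar ''pot'')))))"

text \<open>\<open>target\<close> remembers the last candidate kept; once a single one remains, this
  is the answer.\<close>

definition update_candidates :: program where
  "update_candidates = Seq (NAssign ''cnt'' [] (NConst 0))
     (For ''x'' (If (toward_test ''best'' ''ans'')
       (Seq (NAssign ''cnt'' [] (NAdd (NVar ''cnt'') (NConst 1))) (NAssign ''target'' [] (NVar ''x'')))
       (NAssign ''C'' [NVar ''x''] (NConst 0))))"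

definition search_step :: program where
  "search_step = Seq find_median (Seq (Query ''ans'' (NVar ''best''))
     (If (NEq (NVar ''ans'') (NVar ''best''))
       (Seq (NAssign ''target'' [] (NVar ''best'')) (NAssign ''cnt'' [] (NConst 0)))
       update_candidates))"

definition median_search :: program where
  "median_search = Seq total_weight (Seq init_distances (Seq bellman_ford
     (Seq init_candidates (While (NLess (NConst 1) (NVar ''cnt'')) search_step))))"

section \<open>The input graph in memory\<close>

locale numbered_graph = weighted_graph G w
  for G :: "nat pair_pre_digraph" and w +
  fixes n :: nat
  assumes pverts_eq: "pverts G = {..<n}"
begin

lemma arc_less: "(i, j) \<in> parcs G \<Longrightarrow> i < n \<and> j < n"
  using in_arcsD1 in_arcsD2 pverts_eq by auto

definition weight :: "nat \<Rightarrow> nat \<Rightarrow> real" where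
  "weight i j = (if (i, j) \<in> parcs G then w (i, j) else 0)"

definition loaded :: "(cell \<Rightarrow> nat) \<Rightarrow> (cell \<Rightarrow> real) \<Rightarrow> bool" where
  "loaded N M \<longleftrightarrow> N (''n'', []) = n \<and> (\<forall>i j. N (''adj'', [i, j]) = (if (i, j) \<in> parcs G then 1 else 0)) \<and>
     (\<forall>i j. M (''w'', [i, j]) = weight i j)"

lemma loaded_nmem_update [simp]:
  "x \<noteq> ''n'' \<Longrightarrow> x \<noteq> ''adj'' \<Longrightarrow> loaded (N((x, es) := k)) M = loaded N M"
  by (simp add: loaded_def)

lemma loaded_rmem_update [simp]: "x \<noteq> ''w'' \<Longrightarrow> loaded N (M((x, es) := r)) = loaded N M"
  by (simp add: loaded_def)

lemma loaded_input: "loaded (nmem (input n G w)) (rmem (input n G w))"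
  by (auto simp: loaded_def input_def weight_def)

lemma sum_weight: "(\<Sum>i<n. \<Sum>j<n. weight i j) = sum w (parcs G)"
proof -
  have "(\<Sum>i<n. \<Sum>j<n. weight i j) = (\<Sum>e\<in>{..<n} \<times> {..<n}. weight (fst e) (snd e))"
    by (simp add: sum.cartesian_product case_prod_beta)
  also have "\<dots> = sum w (parcs G)"
    by (rule sum.mono_neutral_cong_right) (auto simp: weight_def dest: arc_less)
  finally show ?thesis .
qed

text \<open>The last assumption describes the final states for an arbitrary \<open>Q\<close>, a form
  that chains backwards through \<open>Seq\<close>. That \<open>target\<close> is still 0 is carried
  along for the case of a single vertex.\<close>

lemma runs_total_weight:
  assumes "loaded (nmem s) (rmem s)" "rmem s (''W'', []) = 0" "transcript s = []"
    "nmem s (''target'', []) = 0"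
    and "\<And>s'. loaded (nmem s') (rmem s') \<Longrightarrow> rmem s' (''W'', []) = sum w (parcs G) \<Longrightarrow>
      transcript s' = [] \<Longrightarrow> nmem s' (''target'', []) = 0 \<Longrightarrow> Q s'"
  shows "runs R n total_weight s Q"
proof -
  let ?P = "\<lambda>s. loaded (nmem s) (rmem s) \<and> transcript s = [] \<and> nmem s (''target'', []) = 0"
  show ?thesis
    unfolding total_weight_def
  proof (rule runs_For[where I = "\<lambda>i s. ?P s \<and> rmem s (''W'', []) = (\<Sum>a<i. \<Sum>b<n. weight a b)"], goal_cases)
    case (3 i s)
    then show ?case
      by (intro runs_For[where I = "\<lambda>j s. ?P s \<and> nmem s (''i'', []) = i \<and>
          rmem s (''W'', []) = (\<Sum>a<i. \<Sum>b<n. weight a b) + (\<Sum>b<j. weight i b)"] runs_RAssign)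
        (auto simp: loaded_def)
  qed (use assms in \<open>auto simp: sum_weight loaded_def\<close>)
qed

section \<open>Correctness of the Bellman-Ford phase\<close>

definition distances_upto :: "nat \<Rightarrow> (cell \<Rightarrow> real) \<Rightarrow> bool" where
  "distances_upto r M \<longleftrightarrow> (\<forall>i<n. \<forall>j<n. distance i j \<le> M (''d'', [i, j]) \<and>
     (\<forall>p. awalk i p j \<and> length p \<le> r \<longrightarrow> M (''d'', [i, j]) \<le> awalk_cost w p))"

text \<open>
  The quantification over all walks makes this stable under later decreases of the distance matrix,
  which is updated in place.
\<close>

definition relaxed :: "nat \<Rightarrow> (cell \<Rightarrow> real) \<Rightarrow> nat \<Rightarrow> nat \<Rightarrow> nat \<Rightarrow> bool" where
  "relaxed r M i u j \<longleftrightarrow> (\<forall>p. awalk i ((i, u) # p) j \<and> length p \<le> r \<longrightarrow>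
     M (''d'', [i, j]) \<le> awalk_cost w ((i, u) # p))"

lemma runs_init_distances:
  assumes "loaded (nmem s) (rmem s)" "rmem s (''W'', []) = sum w (parcs G)" "transcript s = []"
    "nmem s (''target'', []) = 0"
    and "\<And>s'. loaded (nmem s') (rmem s') \<Longrightarrow> distances_upto 0 (rmem s') \<Longrightarrow>
      transcript s' = [] \<Longrightarrow> nmem s' (''target'', []) = 0 \<Longrightarrow> Q s'"
  shows "runs R n init_distances s Q"
proof -
  let ?P = "\<lambda>s. loaded (nmem s) (rmem s) \<and> rmem s (''W'', []) = sum w (parcs G) \<and> transcript s = [] \<and>
    nmem s (''target'', []) = 0"
  let ?e = "\<lambda>i j. if i = j then 0 else sum w (parcs G)"
  show ?thesis
    unfolding init_distances_def
  proof (rule runs_For[where I = "\<lambda>i s. ?P s \<and> (\<forall>a<i. \<forall>b<n. rmem s (''d'', [a, b]) = ?e a b)"],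
      goal_cases)
    case (3 i s)
    then show ?case
      by (intro runs_For[where I = "\<lambda>j s. ?P s \<and> nmem s (''i'', []) = i \<and>
          (\<forall>a<i. \<forall>b<n. rmem s (''d'', [a, b]) = ?e a b) \<and> (\<forall>b<j. rmem s (''d'', [i, b]) = ?e i b)"]
          runs_If runs_RAssign)
        (auto simp: loaded_def less_Suc_eq)
  next
    case (4 s)
    \<comment> \<open>Only empty walks have at most 0 arcs; they cost 0 and occur on the diagonal
      alone. Elsewhere just the lower bound matters.\<close>
    have "distances_upto 0 (rmem s)"
      unfolding distances_upto_def
      using 4 distance_le_total_weight distance_self by (auto simp: pverts_eq awalk_Nil_iff)
    then show ?case using 4 assms(5) by blast
  qed (use assms in \<open>auto simp: loaded_def\<close>)
qed

text \<open>A nonempty walk with at most \<open>Suc r\<close> arcs is a first arc followed by a walk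
  with at most \<open>r\<close> arcs, the case covered by \<open>relaxed\<close>.\<close>

lemma distances_upto_Suc:
  assumes "distances_upto r M" "\<And>i u j. i < n \<Longrightarrow> u < n \<Longrightarrow> j < n \<Longrightarrow> relaxed r M i u j"
  shows "distances_upto (Suc r) M"
  unfolding distances_upto_def
proof (intro allI impI conjI; (elim conjE)?)
  fix i j p assume ij: "i < n" "j < n"
  show "distance i j \<le> M (''d'', [i, j])" using assms(1) ij by (simp add: distances_upto_def)
  assume p: "awalk i p j" "length p \<le> Suc r"
  show "M (''d'', [i, j]) \<le> awalk_cost w p"
  proof (cases p)
    case Nil
    have "\<forall>p. awalk i p j \<and> length p \<le> r \<longrightarrow> M (''d'', [i, j]) \<le> awalk_cost w p"
      using assms(1) ij by (simp add: distances_upto_def)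
    from this[rule_format, of "[]"] show ?thesis using p Nil by simp
  next
    case (Cons e q)
    then obtain u where e: "e = (i, u)" "(i, u) \<in> parcs G"
      using p by (cases e) (auto simp: awalk_Cons_iff)
    then show ?thesis
      using assms(2)[of i u j] ij p Cons arc_less[OF e(2)] by (auto simp: relaxed_def)
  qed
qed

lemma distances_upto_decrease:
  assumes "distances_upto r M" "i < n" "j < n" "distance i j \<le> e" "e \<le> M (''d'', [i, j])"
  shows "distances_upto r (M((''d'', [i, j]) := e))"
  using assms unfolding distances_upto_def by (auto intro: order_trans)

lemma relaxed_decrease:
  assumes "relaxed r M a b c" "e \<le> M (''d'', [i, j])"
  shows "relaxed r (M((''d'', [i, j]) := e)) a b c"
  using assms unfolding relaxed_def by (auto intro: order_trans)

text \<open>Here \<open>M\<close> is the matrix before a relaxation and \<open>M'\<close> the one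
  after it. The entry of \<open>M\<close> at \<open>u\<close> and \<open>j\<close> bounds the tail
  of the walk, and the first arc adds its weight.\<close>

lemma relaxedI:
  assumes "distances_upto r M" "j < n"
    and "(i, u) \<in> parcs G \<Longrightarrow> M' (''d'', [i, j]) \<le> w (i, u) + M (''d'', [u, j])"
  shows "relaxed r M' i u j"
  unfolding relaxed_def
proof (intro allI impI, elim conjE)
  fix p assume p: "awalk i ((i, u) # p) j" "length p \<le> r"
  then have arc: "(i, u) \<in> parcs G" "awalk u p j" by (auto simp: awalk_Cons_iff)
  then have "M (''d'', [u, j]) \<le> awalk_cost w p"
    using assms(1,2) p(2) arc_less unfolding distances_upto_def by blast
  then show "M' (''d'', [i, j]) \<le> awalk_cost w ((i, u) # p)"
    using assms(3)[OF arc(1)] by simp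
qed

text \<open>Entries only decrease, so earlier relaxations stay valid; \<open>Q\<close> receives this
  as its last premise.\<close>

lemma runs_relax:
  assumes "loaded (nmem s) (rmem s)" "distances_upto r (rmem s)"
    and ijk: "i < n" "u < n" "j < n" "nmem s (''i'', []) = i" "nmem s (''u'', []) = u" "nmem s (''j'', []) = j"
    and Q: "\<And>M. loaded (nmem s) M \<Longrightarrow> distances_upto r M \<Longrightarrow> relaxed r M i u j \<Longrightarrow>
      (\<And>a b c. relaxed r (rmem s) a b c \<Longrightarrow> relaxed r M a b c) \<Longrightarrow> Q (s\<lparr>rmem := M\<rparr>)"
  shows "runs R n relax s Q"
  unfolding relax_def
proof (rule runs_If)
  let ?e = "w (i, u) + rmem s (''d'', [u, j])"
  assume "bval s (BAnd (arc_test (NVar ''i'') (NVar ''u''))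
    (RLess (via (NVar ''i'') (NVar ''u'') (NVar ''j'')) (RCell ''d'' [NVar ''i'', NVar ''j''])))"
  then have arc: "(i, u) \<in> parcs G" and less: "?e \<le> rmem s (''d'', [i, j])"
    using assms(1) ijk by (auto simp: arc_test_def via_def loaded_def weight_def split: if_splits)
  \<comment> \<open>By the triangle inequality, since the entry at \<open>u\<close> and
    \<open>j\<close> is not below the distance.\<close>
  have "distance i j \<le> ?e"
    using distance_le_arc[OF arc, of j] assms(2) ijk pverts_eq by (force simp: distances_upto_def)
  note upd = distances_upto_decrease[OF assms(2) ijk(1,3) this less]
  have "relaxed r ((rmem s)((''d'', [i, j]) := ?e)) i u j"
    by (rule relaxedI[OF assms(2) ijk(3)]) simp
  then have "Q (s\<lparr>rmem := (rmem s)((''d'', [i, j]) := ?e)\<rparr>)"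
    using assms(1) upd relaxed_decrease[where M = "rmem s" and i = i and j = j, OF _ less] by (intro Q) auto
  then show "runs R n (RAssign ''d'' [NVar ''i'', NVar ''j''] (via (NVar ''i'') (NVar ''u'') (NVar ''j''))) s Q"
    using arc assms(1) ijk by (intro runs_RAssign) (simp add: via_def loaded_def weight_def)
next
  assume "\<not> bval s (BAnd (arc_test (NVar ''i'') (NVar ''u''))
    (RLess (via (NVar ''i'') (NVar ''u'') (NVar ''j'')) (RCell ''d'' [NVar ''i'', NVar ''j''])))"
  then have "(i, u) \<in> parcs G \<Longrightarrow> rmem s (''d'', [i, j]) \<le> w (i, u) + rmem s (''d'', [u, j])"
    using assms(1) ijk by (auto simp: arc_test_def via_def loaded_def weight_def)
  then have "relaxed r (rmem s) i u j" by (rule relaxedI[OF assms(2) ijk(3)])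
  then have "Q (s\<lparr>rmem := rmem s\<rparr>)" using assms by (intro Q) auto
  then show "runs R n Skip s Q" by (intro runs_Skip) simp
qed

definition distances_known :: "(cell \<Rightarrow> real) \<Rightarrow> bool" where
  "distances_known M \<longleftrightarrow> (\<forall>i<n. \<forall>j<n. M (''d'', [i, j]) = distance i j)"

text \<open>A shortest path repeats no vertex and so has fewer than \<open>n\<close> arcs; after
  \<open>n\<close> rounds the upper bound therefore meets the lower one.\<close>

lemma distances_upto_card:
  assumes "distances_upto n M"
  shows "distances_known M"
  unfolding distances_known_def
proof (intro allI impI antisym)
  fix i j assume ij: "i < n" "j < n"
  then show "distance i j \<le> M (''d'', [i, j])" using assms by (auto simp: distances_upto_def)
  obtain p where p: "apath i p j" "distance i j = awalk_cost w p"
    using shortest_apath[of i j] ij pverts_eq by auto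
  then have "awalk i p j" "length p \<le> n"
    using length_apath_less[of i p j] pverts_eq by (auto simp: apath_def)
  then show "M (''d'', [i, j]) \<le> distance i j"
    using p(2) assms ij by (auto simp: distances_upto_def)
qed

text \<open>The nested invariants record the triples relaxed in the current round: all those of
  earlier sources (\<open>?row\<close>), those of the current source with earlier first neighbors
  (\<open>?col\<close>), and a prefix of the remaining ones.\<close>

lemma runs_bellman_ford:
  assumes "loaded (nmem s) (rmem s)" "distances_upto 0 (rmem s)" "transcript s = []"
    "nmem s (''target'', []) = 0"
    and "\<And>s'. loaded (nmem s') (rmem s') \<Longrightarrow> distances_known (rmem s') \<Longrightarrow>
      transcript s' = [] \<Longrightarrow> nmem s' (''target'', []) = 0 \<Longrightarrow> Q s'"
  shows "runs R n bellman_ford s Q"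
proof -
  let ?P = "\<lambda>r s. loaded (nmem s) (rmem s) \<and> distances_upto r (rmem s) \<and> transcript s = [] \<and>
    nmem s (''target'', []) = 0"
  let ?row = "\<lambda>r i s. \<forall>a<i. \<forall>b<n. \<forall>c<n. relaxed r (rmem s) a b c"
  let ?col = "\<lambda>r i u s. \<forall>b<u. \<forall>c<n. relaxed r (rmem s) i b c"
  show ?thesis
    unfolding bellman_ford_def
  proof (rule runs_For[where I = ?P], goal_cases)
    case (3 r s)
    show ?case
    proof (rule runs_For[where I = "\<lambda>i s. ?P r s \<and> nmem s (''r'', []) = r \<and> ?row r i s"], goal_cases)
      case (3 i s)
      show ?case
      proof (rule runs_For[where I = "\<lambda>u s. ?P r s \<and> nmem s (''r'', []) = r \<and> nmem s (''i'', []) = i \<and>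
            ?row r i s \<and> ?col r i u s"], goal_cases)
        case (3 u s)
        show ?case
        proof (rule runs_For[where I = "\<lambda>j s. ?P r s \<and> nmem s (''r'', []) = r \<and> nmem s (''i'', []) = i \<and>
            nmem s (''u'', []) = u \<and> ?row r i s \<and> ?col r i u s \<and> (\<forall>c<j. relaxed r (rmem s) i u c)"],
            goal_cases)
          case (3 j s)
          then show ?case
            using \<open>i < n\<close> \<open>u < n\<close> by (intro runs_relax[where r = r]) (auto simp: less_Suc_eq)
        qed (use 3 in \<open>auto simp: less_Suc_eq\<close>)
      qed (use 3 in \<open>auto simp: less_Suc_eq\<close>)
    next
      case (4 s')
      \<comment> \<open>All triples are relaxed at the end of the round, which raises the number of
        arcs by one.\<close>
      then show ?case using distances_upto_Suc[of r "rmem s'"] by simp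
    qed (use 3 in \<open>auto simp: less_Suc_eq\<close>)
  qed (use assms distances_upto_card in \<open>auto simp: loaded_def\<close>)
qed

section \<open>Candidates, potentials and medians in memory\<close>

definition marked :: "(cell \<Rightarrow> nat) \<Rightarrow> nat set" where
  "marked N = {x. x < n \<and> N (''C'', [x]) = 1}"

definition ready :: "state \<Rightarrow> bool" where
  "ready s \<longleftrightarrow> loaded (nmem s) (rmem s) \<and> distances_known (rmem s)"

lemma ready_n: "ready s \<Longrightarrow> nmem s (''n'', []) = n"
  by (simp add: ready_def loaded_def)

lemma marked_update [simp]: "x \<noteq> ''C'' \<Longrightarrow> marked (N((x, es) := k)) = marked N"
  by (simp add: marked_def)

lemma marked_subset: "marked N \<subseteq> {..<n}"
  by (auto simp: marked_def)

lemma ready_keeps: "ready s \<Longrightarrow> keeps X s s' \<Longrightarrow> ''n'' \<notin> X \<Longrightarrow> ''adj'' \<notin> X \<Longrightarrow> ready s'"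
  by (auto simp: ready_def loaded_def keeps_def agree_def)

lemma marked_keeps: "keeps X s s' \<Longrightarrow> ''C'' \<notin> X \<Longrightarrow> marked (nmem s') = marked (nmem s)"
  by (auto simp: marked_def keeps_def agree_def)

lemma nmem_keeps: "keeps X s s' \<Longrightarrow> x \<notin> X \<Longrightarrow> nmem s' (x, es) = nmem s (x, es)"
  by (auto simp: keeps_def agree_def)

lemma bval_arc_test:
  assumes "ready s"
  shows "bval s (arc_test a b) \<longleftrightarrow> nval s b \<in> nbrs (nval s a)"
  using assms by (auto simp: arc_test_def ready_def loaded_def nbrs_def)

text \<open>Stored distances and real arithmetic are exact, so the comparison decides the equation
  of \<open>toward_iff\<close>.\<close>

lemma bval_toward_test:
  assumes "ready s" "nmem s (a, []) = v" "nmem s (b, []) = u" "nmem s (''x'', []) = x"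
    and "u \<in> nbrs v" "x < n"
  shows "bval s (toward_test a b) \<longleftrightarrow> nmem s (''C'', [x]) = 1 \<and> x \<in> toward v u"
proof -
  have "(v, u) \<in> parcs G" using assms by (simp add: nbrs_def)
  moreover from this have "v < n" "u < n" using arc_less by auto
  ultimately show ?thesis
    using assms toward_iff[OF assms(5), of x]
    by (auto simp: toward_test_def via_def ready_def loaded_def distances_known_def weight_def pverts_eq)
qed

lemma runs_count_toward:
  assumes "ready s" "nmem s (''v'', []) = v" "nmem s (''u'', []) = u" "u \<in> nbrs v"
    and Q: "\<And>s'. keeps {''c'', ''x''} s s' \<Longrightarrow>
      nmem s' (''c'', []) = card (toward v u \<inter> marked (nmem s)) \<Longrightarrow> Q s'"
  shows "runs R n count_toward s Q"
proof -
  let ?S = "toward v u \<inter> marked (nmem s)"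
  have Suc: "?S \<inter> {..<Suc i} = (if i \<in> ?S then insert i (?S \<inter> {..<i}) else ?S \<inter> {..<i})" for i
    by (auto simp: less_Suc_eq)
  have "finite ?S" using finite_subset[OF marked_subset] by blast
  then have card_Suc: "card (?S \<inter> {..<Suc i}) =
      (if i \<in> ?S then Suc (card (?S \<inter> {..<i})) else card (?S \<inter> {..<i}))" for i
    unfolding Suc by simp
  have S: "?S \<inter> {..<n} = ?S" using marked_subset by blast
  show ?thesis
    unfolding count_toward_def
  proof (intro runs_Seq runs_NAssign runs_For[where I = "\<lambda>i s'. keeps {''c'', ''x''} s s' \<and>
        nmem s' (''c'', []) = card (?S \<inter> {..<i})"], goal_cases)
    case (3 i s')
    then have k: "keeps {''c'', ''x''} s s'" by simp
    have ready: "ready s'" using ready_keeps[OF assms(1) k] by simp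
    have "nmem s' (''v'', []) = v" "nmem s' (''u'', []) = u"
      using assms nmem_keeps[OF k] by auto
    note test = bval_toward_test[OF ready this \<open>nmem s' (''x'', []) = i\<close> assms(4) \<open>i < n\<close>]
    have C: "nmem s' (''C'', [i]) = 1 \<longleftrightarrow> i \<in> marked (nmem s)"
      using \<open>i < n\<close> nmem_keeps[OF k] by (simp add: marked_def)
    show ?case
      by (rule runs_If; intro runs_intros) (use 3 test C in \<open>(simp_all add: card_Suc keeps_def, blast?)\<close>)
  next
    case (4 s')
    then show ?case using S Q by simp
  qed (use assms in \<open>auto simp: ready_n keeps_def\<close>)
qed

lemma runs_compute_potential:
  assumes "ready s" "nmem s (''v'', []) = v" "nbrs v \<noteq> {}"
    and Q: "\<And>s'. keeps {''c'', ''x'', ''u'', ''pot''} s s' \<Longrightarrow>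
      nmem s' (''pot'', []) = potential (marked (nmem s)) v \<Longrightarrow> Q s'"
  shows "runs R n compute_potential s Q"
proof -
  let ?X = "{''c'', ''x'', ''u'', ''pot''}"
  let ?f = "\<lambda>u. card (toward v u \<inter> marked (nmem s))"
  \<comment> \<open>The inserted 0 gives the maximum a value before the first neighbor, matching the
    initial \<open>pot\<close>. Once there is a neighbor it changes nothing, as cardinalities are
    nonnegative.\<close>
  define M where "M i = Max (insert 0 (?f ` (nbrs v \<inter> {..<i})))" for i
  have Suc: "M (Suc i) = (if i \<in> nbrs v then max (?f i) (M i) else M i)" for i
  proof (cases "i \<in> nbrs v")
    case True
    then have "insert 0 (?f ` (nbrs v \<inter> {..<Suc i})) = insert (?f i) (insert 0 (?f ` (nbrs v \<inter> {..<i})))"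
      by (auto simp: less_Suc_eq)
    then have "M (Suc i) = Max (insert (?f i) (insert 0 (?f ` (nbrs v \<inter> {..<i}))))"
      unfolding M_def by (rule arg_cong)
    also have "\<dots> = max (?f i) (M i)" unfolding M_def by (rule Max_insert) auto
    finally show ?thesis using True by simp
  next
    case False
    then have "nbrs v \<inter> {..<Suc i} = nbrs v \<inter> {..<i}" by (auto simp: less_Suc_eq)
    then show ?thesis using False by (simp add: M_def)
  qed
  have "nbrs v \<inter> {..<n} = nbrs v" using arc_less by (auto simp: nbrs_def)
  then have M_n: "M n = potential (marked (nmem s)) v"
    using assms(3) finite_nbrs by (simp add: potential_def M_def)
  show ?thesis
    unfolding compute_potential_def
  proof (intro runs_Seq runs_NAssign runs_For[where I = "\<lambda>i s'. keeps ?X s s' \<and>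
        nmem s' (''pot'', []) = M i"], goal_cases)
    case (3 i s')
    then have k: "keeps ?X s s'" by simp
    have ready: "ready s'" using ready_keeps[OF assms(1) k] by simp
    have v: "nmem s' (''v'', []) = v"
      using assms nmem_keeps[OF k] by auto
    show ?case
    proof (rule runs_If)
      assume "bval s' (arc_test (NVar ''v'') (NVar ''u''))"
      then have i: "i \<in> nbrs v" using bval_arc_test[OF ready] v 3 by simp
      show "runs R n (Seq count_toward (If (NLess (NVar ''pot'') (NVar ''c''))
          (NAssign ''pot'' [] (NVar ''c'')) Skip)) s' (\<lambda>s''. nmem s'' (''u'', []) = i \<and>
          nmem s'' (''n'', []) = n \<and> keeps ?X s (s''\<lparr>nmem := (nmem s'')((''u'', []) := Suc i)\<rparr>) \<and>
          nmem (s''\<lparr>nmem := (nmem s'')((''u'', []) := Suc i)\<rparr>) (''pot'', []) = M (Suc i))"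
      proof (rule runs_Seq, rule runs_count_toward[OF ready v _ i], goal_cases)
        case (2 s'')
        then have "keeps ?X s s''" using keeps_trans[OF k] by simp
        moreover have "nmem s'' (''c'', []) = ?f i"
          using 2 marked_keeps[OF k] by simp
        moreover have "nmem s'' (''pot'', []) = M i" "nmem s'' (''u'', []) = i" "nmem s'' (''n'', []) = n"
          using nmem_keeps[OF 2(1)] 3 by auto
        ultimately show ?case
          by (intro runs_If runs_NAssign runs_Skip) (simp_all add: Suc i keeps_def max_def)
      qed (use 3 in simp)
    next
      assume "\<not> bval s' (arc_test (NVar ''v'') (NVar ''u''))"
      then have "i \<notin> nbrs v" using bval_arc_test[OF ready] v 3 by simp
      then show "runs R n Skip s' (\<lambda>s''. nmem s'' (''u'', []) = i \<and>
          nmem s'' (''n'', []) = n \<and> keeps ?X s (s''\<lparr>nmem := (nmem s'')((''u'', []) := Suc i)\<rparr>) \<and>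
          nmem (s''\<lparr>nmem := (nmem s'')((''u'', []) := Suc i)\<rparr>) (''pot'', []) = M (Suc i))"
        using 3 by (intro runs_Skip) (simp add: Suc keeps_def)
    qed
  next
    case (4 s')
    then show ?case using M_n Q by simp
  qed (use assms in \<open>auto simp: ready_n keeps_def M_def\<close>)
qed

lemma runs_find_median:
  assumes "ready s" "0 < n" "\<And>v. v < n \<Longrightarrow> nbrs v \<noteq> {}"
    and Q: "\<And>s' v. keeps {''c'', ''x'', ''u'', ''pot'', ''v'', ''best'', ''min''} s s' \<Longrightarrow>
      nmem s' (''best'', []) = v \<Longrightarrow> v < n \<Longrightarrow>
      (\<And>u. u < n \<Longrightarrow> potential (marked (nmem s)) v \<le> potential (marked (nmem s)) u) \<Longrightarrow> Q s'"
  shows "runs R n find_median s Q"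
proof -
  let ?X = "{''c'', ''x'', ''u'', ''pot'', ''v'', ''best'', ''min''}"
  let ?p = "potential (marked (nmem s))"
  \<comment> \<open>Nothing is claimed at \<open>i = 0\<close>, where \<open>best\<close> and
    \<open>min\<close> may be left over from an earlier search step.\<close>
  let ?I = "\<lambda>i s'. keeps ?X s s' \<and> (0 < i \<longrightarrow> nmem s' (''best'', []) < i \<and>
    nmem s' (''min'', []) = ?p (nmem s' (''best'', [])) \<and> (\<forall>u<i. ?p (nmem s' (''best'', [])) \<le> ?p u))"
  show ?thesis
    unfolding find_median_def
  proof (rule runs_For[where I = ?I], goal_cases)
    case (3 i s')
    then have k: "keeps ?X s s'" by simp
    have ready: "ready s'" using ready_keeps[OF assms(1) k] by simp
    show ?case
    proof (rule runs_Seq, rule runs_compute_potential[where v = i, OF ready _ assms(3)], goal_cases)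
      case (3 s'')
      have k': "keeps ?X s s''" using keeps_trans[OF k 3(1)] by simp
      have pot: "nmem s'' (''pot'', []) = ?p i"
        using 3 marked_keeps[OF k] by simp
      have eqs: "nmem s'' (''best'', []) = nmem s' (''best'', [])" "nmem s'' (''min'', []) = nmem s' (''min'', [])"
        "nmem s'' (''v'', []) = nmem s' (''v'', [])" "nmem s'' (''n'', []) = nmem s' (''n'', [])"
        using 3(1) by (simp_all add: nmem_keeps)
      have v: "nmem s'' (''v'', []) = i" and n: "nmem s'' (''n'', []) = n"
        using eqs \<open>nmem s' (''v'', []) = i\<close> \<open>nmem s' (''n'', []) = n\<close> by simp_all
      have I: "0 < i \<longrightarrow> nmem s'' (''best'', []) < i \<and>
          nmem s'' (''min'', []) = ?p (nmem s'' (''best'', [])) \<and> (\<forall>u<i. ?p (nmem s'' (''best'', [])) \<le> ?p u)"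
        using \<open>?I i s'\<close> by (simp add: eqs)
      \<comment> \<open>Either there is no earlier vertex, or the new one beats the previous best,
        which is minimal among the earlier ones.\<close>
      have min: "?p i \<le> ?p u" if "i = 0 \<or> ?p i < nmem s'' (''min'', [])" "u < Suc i" for u
      proof (cases "u = i")
        case False
        then have "?p i < ?p (nmem s'' (''best'', []))" using I that by auto
        also have "\<dots> \<le> ?p u" using False I that by auto
        finally show ?thesis by simp
      qed simp
      show ?case
      proof (rule runs_If, goal_cases)
        case 1
        then have "0 < i" using v by simp
        then show ?case
          using 1 I v n pot k' by (intro runs_Skip) (simp add: keeps_def less_Suc_eq)
      next
        case 2
        then have "i = 0 \<or> ?p i < nmem s'' (''min'', [])" using v pot by simp
        then show ?case
          using min v n pot k' by (intro runs_intros) (simp add: keeps_def)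
      qed
    qed (use 3 in simp_all)
  qed (use assms in \<open>auto simp: ready_n keeps_def\<close>)
qed

text \<open>Marks can be overwritten in place because the test at a vertex reads no other mark:
  those below \<open>i\<close> are final, those from \<open>i\<close> on still original.\<close>

lemma runs_update_candidates:
  assumes "ready s" "nmem s (''best'', []) = v" "nmem s (''ans'', []) = u" "u \<in> nbrs v"
    and Q: "\<And>s'. keeps {''cnt'', ''x'', ''target'', ''C''} s s' \<Longrightarrow>
      marked (nmem s') = marked (nmem s) \<inter> toward v u \<Longrightarrow>
      nmem s' (''cnt'', []) = card (marked (nmem s')) \<Longrightarrow>
      (0 < nmem s' (''cnt'', []) \<Longrightarrow> nmem s' (''target'', []) \<in> marked (nmem s')) \<Longrightarrow> Q s'"
  shows "runs R n update_candidates s Q"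
proof -
  let ?X = "{''cnt'', ''x'', ''target'', ''C''}"
  let ?S = "marked (nmem s) \<inter> toward v u"
  have Suc: "?S \<inter> {..<Suc i} = (if i \<in> ?S then insert i (?S \<inter> {..<i}) else ?S \<inter> {..<i})" for i
    by (auto simp: less_Suc_eq)
  have "finite ?S" using finite_subset[OF marked_subset] by blast
  then have card_Suc: "card (?S \<inter> {..<Suc i}) =
      (if i \<in> ?S then Suc (card (?S \<inter> {..<i})) else card (?S \<inter> {..<i}))" for i
    unfolding Suc by simp
  have S: "?S \<inter> {..<n} = ?S" using marked_subset by blast
  show ?thesis
    unfolding update_candidates_def
  proof (intro runs_Seq runs_NAssign runs_For[where I = "\<lambda>i s'. keeps ?X s s' \<and>
        (\<forall>x<i. nmem s' (''C'', [x]) = 1 \<longleftrightarrow> x \<in> ?S) \<and>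
        (\<forall>x. i \<le> x \<longrightarrow> nmem s' (''C'', [x]) = nmem s (''C'', [x])) \<and>
        nmem s' (''cnt'', []) = card (?S \<inter> {..<i}) \<and>
        (0 < nmem s' (''cnt'', []) \<longrightarrow> nmem s' (''target'', []) \<in> ?S)"], goal_cases)
    case (3 i s')
    then have k: "keeps ?X s s'" by simp
    have ready: "ready s'" using ready_keeps[OF assms(1) k] by simp
    have "nmem s' (''best'', []) = v" "nmem s' (''ans'', []) = u"
      using assms nmem_keeps[OF k] by auto
    note test = bval_toward_test[OF ready this \<open>nmem s' (''x'', []) = i\<close> assms(4) \<open>i < n\<close>]
    have C: "nmem s' (''C'', [i]) = 1 \<longleftrightarrow> i \<in> marked (nmem s)"
      using \<open>i < n\<close> 3 by (simp add: marked_def)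
    show ?case
      by (rule runs_If; intro runs_intros)
        (use 3 test C in \<open>simp_all add: card_Suc keeps_def less_Suc_eq\<close>)
  next
    case (4 s')
    then have "marked (nmem s') = ?S"
      using marked_subset[of "nmem s"] by (auto simp: marked_def)
    then show ?case using 4 S by (intro Q) auto
  qed (use assms in \<open>auto simp: ready_n keeps_def\<close>)
qed

section \<open>The search loop\<close>

definition search_invariant :: "real \<Rightarrow> nat \<Rightarrow> state \<Rightarrow> bool" where
  "search_invariant \<epsilon> t s \<longleftrightarrow> ready s \<and> median_history \<epsilon> t (transcript s) \<and>
     ((t, Here) \<in> set (transcript s) \<and> nmem s (''target'', []) = t \<and> nmem s (''cnt'', []) = 0 \<or>
      (\<forall>x. (x, Here) \<notin> set (transcript s)) \<and> marked (nmem s) = candidates (transcript s) \<and>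
      nmem s (''cnt'', []) = card (marked (nmem s)) \<and> nmem s (''target'', []) \<in> marked (nmem s))"

text \<open>As \<open>cnt\<close> exceeds 1, the second alternative of the invariant holds. An
  answer \<open>Here\<close> leads to the first one; any other answer preserves the second with
  fewer candidates.\<close>

lemma runs_search_step:
  assumes inv: "search_invariant \<epsilon> t s" and cnt: "1 < nmem s (''cnt'', [])"
    and t: "t \<in> pverts G" and honest: "honest t R" and "0 \<le> \<epsilon>"
  shows "runs R n search_step s (\<lambda>s'. search_invariant \<epsilon> t s' \<and> nmem s' (''cnt'', []) < nmem s (''cnt'', []))"
proof -
  let ?h = "transcript s" and ?S = "marked (nmem s)"
  have ready: "ready s" and hist: "median_history \<epsilon> t ?h" and noHere: "\<And>x. (x, Here) \<notin> set ?h"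
    and S: "?S = candidates ?h" and cnt_eq: "nmem s (''cnt'', []) = card ?S"
    using inv cnt by (auto simp: search_invariant_def)
  have undetected: "\<nexists>x. detects ?h x"
    using noHere cnt cnt_eq S by (auto simp: detects_def)
  have tS: "t \<in> ?S" using target_mem_candidates[OF hist t] S by simp
  obtain z where z: "z \<in> ?S" "z \<noteq> t"
    using two_candidates[OF hist t undetected] S by metis
  \<comment> \<open>Every vertex differs from \<open>z\<close> or from \<open>t\<close>.\<close>
  have nbrs: "nbrs v \<noteq> {}" if "v < n" for v
    using nbrs_nonempty[of v z] nbrs_nonempty[of v t] that z t marked_subset by (auto simp: pverts_eq)
  have "0 < n" using t pverts_eq by auto
  show ?thesis
    unfolding search_step_def
  proof (rule runs_Seq, rule runs_find_median[OF ready \<open>0 < n\<close> nbrs], assumption,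
      intro runs_Seq runs_Query, goal_cases)
    case (1 s1 v)
    let ?a = "R ?h v"
    have "v \<in> pverts G" using 1 pverts_eq by simp
    then have valid: "valid_answer t v ?a" using honest by (simp add: honest_def)
    have s1: "ready s1" "marked (nmem s1) = ?S" "transcript s1 = ?h"
      using ready_keeps[OF ready 1(1)] marked_keeps[OF 1(1)] 1(1) by (auto simp: keeps_def)
    have med: "approx_median \<epsilon> (candidates ?h) v"
      using approx_median_if_minimal[OF \<open>v \<in> pverts G\<close>, of "candidates ?h"] 1(4) S \<open>0 \<le> \<epsilon>\<close>
      by (simp add: pverts_eq)
    have hist': "median_history \<epsilon> t (?h @ [(v, ?a)])"
      by (rule median_history.query[OF hist undetected med valid])
    define s2 where "s2 = s1\<lparr>nmem := (nmem s1)((''ans'', []) := answer_code v ?a),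
      transcript := ?h @ [(v, ?a)]\<rparr>"
    have s2: "ready s2" "marked (nmem s2) = ?S" "transcript s2 = ?h @ [(v, ?a)]"
      "nmem s2 (''best'', []) = v" "nmem s2 (''ans'', []) = answer_code v ?a"
      using s1 1(2) by (auto simp: s2_def ready_def)
    have "runs R n (If (NEq (NVar ''ans'') (NVar ''best''))
       (Seq (NAssign ''target'' [] (NVar ''best'')) (NAssign ''cnt'' [] (NConst 0)))
       update_candidates) s2
       (\<lambda>s'. search_invariant \<epsilon> t s' \<and> nmem s' (''cnt'', []) < nmem s (''cnt'', []))"
    proof (cases ?a)
      case Here
      then have "v = t" using valid by (simp add: valid_answer_def)
      then show ?thesis
        using Here s2 hist' cnt
        by (intro runs_intros) (auto simp: answer_code_def search_invariant_def ready_def)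
    next
      case (Toward u)
      then have u: "u \<in> nbrs v" "t \<in> toward v u" using valid by (auto simp: valid_answer_def)
      then have "u \<noteq> v" using no_loops' by (auto simp: nbrs_def)
      have ans: "nmem s2 (''ans'', []) = u" using s2 Toward by (simp add: answer_code_def)
      \<comment> \<open>An exact median leaves at most half of the candidates, fewer than before as
        the set is nonempty.\<close>
      have less: "card (?S \<inter> toward v u) < card ?S"
      proof -
        obtain y where y: "y \<in> pverts G" "2 * potential ?S y \<le> card ?S"
          using exists_potential_le_half[of ?S t z] t z marked_subset[of "nmem s"] by (auto simp: pverts_eq)
        have "card (?S \<inter> toward v u) \<le> potential ?S v"
          using card_toward_le_potential[OF u(1), of ?S] by (simp add: Int_commute)
        also have "\<dots> \<le> potential ?S y" using 1(4) y pverts_eq by simp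
        finally show ?thesis using y(2) cnt cnt_eq by linarith
      qed
      show ?thesis
      proof (rule runs_If)
        show "runs R n update_candidates s2
          (\<lambda>s'. search_invariant \<epsilon> t s' \<and> nmem s' (''cnt'', []) < nmem s (''cnt'', []))"
        proof (rule runs_update_candidates[OF s2(1,4) ans u(1)], goal_cases)
          case (1 s3)
          have "ready s3" using ready_keeps[OF s2(1) 1(1)] by simp
          moreover have tr: "transcript s3 = ?h @ [(v, Toward u)]"
            using 1(1) s2(3) Toward by (simp add: keeps_def)
          \<comment> \<open>The surviving \<open>t\<close> keeps \<open>cnt\<close> positive, so
            \<open>target\<close> holds a marked vertex.\<close>
          moreover have "t \<in> marked (nmem s3)" using 1(2) s2(2) tS u(2) by simp
          then have "0 < card (marked (nmem s3))"
            using finite_subset[OF marked_subset] by (auto simp: card_gt_0_iff)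
          ultimately show ?case
            using 1 s2 hist' noHere S less cnt_eq Toward
            by (auto simp: search_invariant_def candidates_snoc)
        qed
      qed (use ans s2(4) \<open>u \<noteq> v\<close> in simp)
    qed
    then show ?case using 1(2) s1(3) by (simp add: s2_def)
  qed
qed

lemma runs_median_search:
  assumes t: "t \<in> pverts G" and honest: "honest t R" and "0 \<le> \<epsilon>"
  shows "runs R n median_search (input n G w)
    (\<lambda>s. median_history \<epsilon> t (transcript s) \<and> detects (transcript s) t \<and> result s = t)"
  unfolding median_search_def
proof (rule runs_Seq, rule runs_total_weight, goal_cases)
  case (5 s)
  then show ?case
  proof (intro runs_Seq runs_init_distances, goal_cases)
    case (5 s)
    then show ?case
    proof (intro runs_bellman_ford, goal_cases)
      case (5 s)
      have "0 < n" using t pverts_eq by auto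
      have "ready s" using 5 by (simp add: ready_def)
      show ?case
        unfolding init_candidates_def
      proof (intro runs_Seq runs_For[where I = "\<lambda>i s'. keeps {''x'', ''C''} s s' \<and>
          (\<forall>x<i. nmem s' (''C'', [x]) = 1)"], goal_cases)
        case (4 s')
        then have k: "keeps {''x'', ''C''} s s'" by simp
        have "ready s'" using ready_keeps[OF \<open>ready s\<close> k] by simp
        moreover have "marked (nmem s') = {..<n}" using 4 by (auto simp: marked_def)
        moreover have "transcript s' = []" "nmem s' (''target'', []) = 0"
          using k nmem_keeps[OF k, of "''target''"] 5 by (simp_all add: keeps_def)
        \<comment> \<open>The initial 0 in \<open>target\<close> is a vertex, hence a candidate. For
          \<open>n = 1\<close> the loop is never entered and this 0 is the answer.\<close>
        ultimately have inv: "search_invariant \<epsilon> t (s'\<lparr>nmem := (nmem s')((''cnt'', []) := n)\<rparr>)"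
          using \<open>0 < n\<close> by (auto simp: search_invariant_def ready_def candidates_Nil pverts_eq
              intro: median_history.start)
        show ?case
        proof (rule runs_NAssign, rule runs_While[where I = "search_invariant \<epsilon> t" and
            m = "\<lambda>s. nmem s (''cnt'', [])"], goal_cases)
          case 1
          then show ?case using inv 4 by simp
        next
          case 2
          then show ?case using 4 by simp
        next
          case (3 s)
          then show ?case using runs_search_step[OF _ _ t honest \<open>0 \<le> \<epsilon>\<close>] by simp
        next
          case (4 s)
          then have hist: "median_history \<epsilon> t (transcript s)" by (simp add: search_invariant_def)
          show ?case
          proof (cases "(t, Here) \<in> set (transcript s)")
            case True
            then show ?thesis using 4 hist by (auto simp: search_invariant_def detects_def result_def)
          next
            case False
            then have c: "marked (nmem s) = candidates (transcript s)"
              "card (marked (nmem s)) \<le> 1" "nmem s (''target'', []) \<in> marked (nmem s)"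
              using 4 by (auto simp: search_invariant_def)
            \<comment> \<open>At most one candidate is left and \<open>t\<close> is one, so the
              marked vertex in \<open>target\<close> is \<open>t\<close>.\<close>
            have "t \<in> marked (nmem s)" using target_mem_candidates[OF hist t] c by simp
            then have "marked (nmem s) = {t}"
              using c(2) card_le_Suc0_iff_eq[OF finite_subset[OF marked_subset]] by auto
            then show ?thesis using c hist by (auto simp: detects_def result_def)
          qed
        qed
      next
        case (3 i s')
        then show ?case
          by (intro runs_NAssign) (auto simp: keeps_def less_Suc_eq)
      qed (use \<open>ready s\<close> in \<open>auto simp: ready_n keeps_def\<close>)
    qed
  qed
qed (simp_all add: loaded_input, simp_all add: input_def)

end

theorem theorem4:
  fixes \<epsilon> :: real
  assumes "0 \<le> \<epsilon>" and "\<epsilon> < 1"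
  shows
    "(\<forall>(G :: 'a pair_pre_digraph) w t h.
        weighted_graph G w \<and> t \<in> pverts G \<and> weighted_graph.median_history G w \<epsilon> t h \<longrightarrow>
          real (length h) \<le> log 2 (real (card (pverts G))) / (1 - log 2 (1 + \<epsilon>)) \<and>
          (weighted_graph.detects G w h t \<or>
            (\<exists>v. weighted_graph.approx_median G w \<epsilon> (weighted_graph.candidates G w h) v)))
     \<and>
     (\<exists>(c :: program) (p :: nat poly). \<forall>n G w t R.
        weighted_graph G w \<and> pverts G = {..<n} \<and> t \<in> pverts G \<and> weighted_graph.honest G w t R \<longrightarrow>
          (\<exists>k s. exec R c (input n G w) k s \<and> k \<le> poly p n \<and>
            weighted_graph.median_history G w \<epsilon> t (transcript s) \<and>
            weighted_graph.detects G w (transcript s) t \<and>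
            result s = t \<and>
            real (length (transcript s)) \<le> log 2 (real n) / (1 - log 2 (1 + \<epsilon>))))"
proof (rule conjI, goal_cases)
  case 1
  show ?case
  proof (intro allI impI, elim conjE)
    fix G :: "'a pair_pre_digraph" and w t h
    assume G: "weighted_graph G w" and t: "t \<in> pverts G"
      and h: "weighted_graph.median_history G w \<epsilon> t h"
    interpret weighted_graph G w by (rule G)
    show "length h \<le> log 2 (card (pverts G)) / (1 - log 2 (1 + \<epsilon>)) \<and>
        (detects h t \<or> (\<exists>v. approx_median \<epsilon> (candidates h) v))"
      using median_history_length[OF h t assms] exists_approx_median[OF _ assms(1)] t by blast
  qed
next
  case 2
  show ?case
  \<comment> \<open>Both witnesses are independent of \<epsilon>, since only exact medians are
    queried.\<close>
  proof (intro exI[of _ median_search] exI[of _ "cost_poly median_search"] allI impI, elim conjE)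
    fix n t :: nat and G w R
    assume G: "weighted_graph G w" "pverts G = {..<n}" and t: "t \<in> pverts G"
      and honest: "weighted_graph.honest G w t R"
    interpret numbered_graph G w n
      using G by (simp add: numbered_graph_def numbered_graph_axioms_def)
    obtain k s where "exec R median_search (input n G w) k s" "k \<le> poly (cost_poly median_search) n"
      "median_history \<epsilon> t (transcript s)" "detects (transcript s) t" "result s = t"
      using runs_median_search[OF t honest assms(1)] by (auto simp: runs_def)
    moreover from this have "length (transcript s) \<le> log 2 n / (1 - log 2 (1 + \<epsilon>))"
      using median_history_length[OF _ t assms] by (simp add: pverts_eq)
    ultimately show "\<exists>k s. exec R median_search (input n G w) k s \<and> k \<le> poly (cost_poly median_search) n \<and>
        median_history \<epsilon> t (transcript s) \<and> detects (transcript s) t \<and> result s = t \<and>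
        length (transcript s) \<le> log 2 n / (1 - log 2 (1 + \<epsilon>))"
      by blast
  qed
qed

end
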